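(* Let $\pi_1,\pi_2$ be two projection operators from $\mathbb{P}^3$ to projective planes, in generic position, with $3\times 4$ matrices $\mathbf{M}_1,\mathbf{M}_2$, fundamental matrix $\mathbf{F}$, and second epipole $\mathbf{e}_2$. Then the knowledge of $\mathbf{F}$ determines the pair $(\mathbf{M}_1,\mathbf{M}_2)$ modulo the action $\theta_2$ of $Pr_3$. More precisely, $(\mathbf{M}_1,\mathbf{M}_2)$ is equivalent, under the action $\theta_2$, to the pair $$\big([\mathbf{I},\mathbf{0}],\ [\mathbf{H},\mathbf{e}_2]\big),\qquad \mathbf{H}=-\frac{[\mathbf{e}_2]}{\|\mathbf{e}_2\|^2}\,\mathbf{F},$$ where $[\mathbf{e}_2]$ is the $3\times 3$ matrix representing the cross-product by $\mathbf{e}_2$.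
   Context: $\mathbb{P}^n$ denotes complex projective space. A projection operator $\pi_i:\mathbb{P}^3\setminus\{\mathbf{O}_i\}\to\mathbb{P}^2$ with center $\mathbf{O}_i$ is given by a rank-3 complex $3\times4$ matrix $\mathbf{M}_i$, defined up to a nonzero scalar, with $\ker \mathbf{M}_i$ spanned by $\mathbf{O}_i$, via $\mathbf{P}\mapsto \mathbf{M}_i\mathbf{P}$. The centers $\mathbf{O}_1\ne\mathbf{O}_2$ are distinct. The epipoles are the points where the line $\overline{\mathbf{O}_1\mathbf{O}_2}$ meets the two projection planes, i.e. $\mathbf{e}_1=\mathbf{M}_1\mathbf{O}_2$ and $\mathbf{e}_2=\mathbf{M}_2\mathbf{O}_1$ (up to scalar). The fundamental matrix $\mathbf{F}$ of $(\pi_1,\pi_2)$ is the $3\times 3$ matrix, defined up to a nonzero scalar, such that for every $\mathbf{p}\neq \mathbf{e}_1$ in the first plane, $\mathbf{F}\mathbf{p}$ is the coordinate vector of the line $\pi_2(\pi_1^{-1}(\mathbf{p}))$ in the second plane; it satisfies $\mathbf{F}\mathbf{e}_1=\mathbf{0}$ and $\mathbf{e}_2^T\mathbf{F}=\mathbf{0}$ (so $\mathbf{e}_2$ is determined by $\mathbf{F}$). $Pr_3$ is the group of projective transformations of $\mathbb{P}^3$. The action $\theta_2$ of $\mathbf{A}\in Pr_3$ on pairs of projection matrices (each taken up to a nonzero scalar) is $(\mathbf{M}_1,\mathbf{M}_2)\mapsto(\mathbf{M}_1\mathbf{A}^{-1},\mathbf{M}_2\mathbf{A}^{-1})$. For $\mathbf{x}=[x_1,x_2,x_3]^T\in\mathbb{C}^3$,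 $$[\mathbf{x}]=\begin{bmatrix} 0 & -x_3 & x_2 \\ x_3 & 0 & -x_1 \\ -x_2 & x_1 & 0 \end{bmatrix}.$$ Here $\|\mathbf{e}_2\|^2=\mathbf{e}_2^T\mathbf{e}_2$, which is nonzero by genericity. $\mathbf{I}$ is the $3\times3$ identity matrix and $\mathbf{0}$ the zero column. *)

theory Defs
  imports "HOL-Analysis.Analysis"
begin

text \<open>
  Points of complex projective space are represented by nonzero vectors of homogeneous
  coordinates, and projection matrices by matrices, both modulo the relations below.
\<close>

definition vec_proj_eq :: "complex^'n \<Rightarrow> complex^'n \<Rightarrow> bool" where
  "vec_proj_eq x y \<longleftrightarrow> (\<exists>c. c \<noteq> 0 \<and> x = c *s y)"

definition mat_proj_eq :: "complex^'n^'m \<Rightarrow> complex^'n^'m \<Rightarrow> bool" where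
  "mat_proj_eq A B \<longleftrightarrow> (\<exists>c. c \<noteq> 0 \<and> A = map_matrix ((*) c) B)"

definition projection_matrix :: "complex^4^3 \<Rightarrow> bool" where
  "projection_matrix M \<longleftrightarrow> rank M = 3"

definition is_center :: "complex^4^3 \<Rightarrow> complex^4 \<Rightarrow> bool" where
  "is_center M C \<longleftrightarrow> C \<noteq> 0 \<and> {P. M *v P = 0} = vec.span {C}"

text \<open>
  The epipole in the plane of \<open>M\<close>, i.e. the image under \<open>M\<close> of the center of \<open>N\<close>.
  The first epipole of \<open>(M\<^sub>1, M\<^sub>2)\<close> is thus given by \<open>is_epipole M\<^sub>1 M\<^sub>2\<close>,
  the second one by \<open>is_epipole M\<^sub>2 M\<^sub>1\<close>.
\<close>

definition is_epipole :: "complex^4^3 \<Rightarrow> complex^4^3 \<Rightarrow> complex^3 \<Rightarrow> bool" where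
  "is_epipole M N e \<longleftrightarrow> (\<exists>C. is_center N C \<and> vec_proj_eq e (M *v C))"

definition preimage_point :: "complex^4^3 \<Rightarrow> complex^3 \<Rightarrow> (complex^4) set" where
  "preimage_point M p = {P. P \<noteq> 0 \<and> vec_proj_eq (M *v P) p}"

text \<open>
  \<open>l\<close> is a coordinate vector of the line spanned by the set \<open>S\<close> of points of the plane.
\<close>

definition is_line_coords :: "complex^3 \<Rightarrow> (complex^3) set \<Rightarrow> bool" where
  "is_line_coords l S \<longleftrightarrow> l \<noteq> 0 \<and> vec.span S = {q. scalar_product l q = 0}"

text \<open>
  The set-theoretic preimage of \<open>p\<close> under the first projection is a line without the center
  of the projection, so its image in the second plane is a line without the second epipole;
  taking the span in \<open>is_line_coords\<close> restores the missing point. A matrix satisfying the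
  condition is nonzero and determined up to a nonzero scalar.
\<close>

definition is_fundamental_matrix ::
    "complex^4^3 \<Rightarrow> complex^4^3 \<Rightarrow> complex^3^3 \<Rightarrow> bool" where
  "is_fundamental_matrix M\<^sub>1 M\<^sub>2 F \<longleftrightarrow>
     (\<forall>p. p \<noteq> 0 \<and> \<not> is_epipole M\<^sub>1 M\<^sub>2 p \<longrightarrow>
        is_line_coords (F *v p) ((*v) M\<^sub>2 ` preimage_point M\<^sub>1 p))"

text \<open>
  \<open>scalar_product e e\<close> is the bilinear \<open>e\<^sup>T e\<close>, without complex conjugation,
  so it may vanish for nonzero \<open>e\<close>.
\<close>

definition generic_position :: "complex^4^3 \<Rightarrow> complex^4^3 \<Rightarrow> bool" where
  "generic_position M\<^sub>1 M\<^sub>2 \<longleftrightarrow>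
     (\<forall>C\<^sub>1 C\<^sub>2. is_center M\<^sub>1 C\<^sub>1 \<and> is_center M\<^sub>2 C\<^sub>2 \<longrightarrow> \<not> vec_proj_eq C\<^sub>1 C\<^sub>2) \<and>
     (\<forall>e\<^sub>2. is_epipole M\<^sub>2 M\<^sub>1 e\<^sub>2 \<longrightarrow> scalar_product e\<^sub>2 e\<^sub>2 \<noteq> 0)"

definition theta2 ::
    "complex^4^4 \<Rightarrow> (complex^4^3) \<times> (complex^4^3) \<Rightarrow> (complex^4^3) \<times> (complex^4^3)" where
  "theta2 A MM = (fst MM ** matrix_inv A, snd MM ** matrix_inv A)"

definition theta2_equivalent ::
    "(complex^4^3) \<times> (complex^4^3) \<Rightarrow> (complex^4^3) \<times> (complex^4^3) \<Rightarrow> bool" where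
  "theta2_equivalent MM NN \<longleftrightarrow>
     (\<exists>A. invertible A \<and> mat_proj_eq (fst (theta2 A MM)) (fst NN)
                       \<and> mat_proj_eq (snd (theta2 A MM)) (snd NN))"

definition cross_matrix :: "complex^3 \<Rightarrow> complex^3^3" where
  "cross_matrix x = vector
     [vector [0, - (x$3), x$2],
      vector [x$3, 0, - (x$1)],
      vector [- (x$2), x$1, 0]]"

definition append_column :: "complex^3^3 \<Rightarrow> complex^3 \<Rightarrow> complex^4^3" where
  "append_column A v = (\<chi> i. vector [A$i$1, A$i$2, A$i$3, v$i])"

end

theory Submission
  imports Defs
begin

text \<open>
  Write \<open>K = [e\<^sub>2] M\<^sub>2\<close>. A point \<open>P\<close> of space has \<open>K P \<noteq> 0\<close> exactly when its image \<open>M\<^sub>2 P\<close>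
  is a point other than \<open>e\<^sub>2\<close>, and then \<open>K P\<close> is the line joining \<open>e\<^sub>2\<close> to \<open>M\<^sub>2 P\<close>. This is also the
  line \<open>F M\<^sub>1 P\<close>, since the viewing ray of \<open>M\<^sub>1 P\<close> is spanned by \<open>P\<close> and the first center. Two linear
  maps that are pointwise proportional in this way, one of them of rank at least two, are
  globally proportional. Hence there is a single constant \<open>c \<noteq> 0\<close> with
  \<open>F M\<^sub>1 = c [e\<^sub>2] M\<^sub>2\<close> (lemma \<open>fundamental_matrix_times_projection\<close>). Everything else is read
  off from this identity.

  For the normal form, put \<open>n = e\<^sub>2\<^sup>T e\<^sub>2\<close> and use \<open>[e\<^sub>2] [e\<^sub>2] = e\<^sub>2 e\<^sub>2\<^sup>T - n I\<close>: then
  \<open>H M\<^sub>1 = - (c / n) [e\<^sub>2] [e\<^sub>2] M\<^sub>2 = c M\<^sub>2 - e\<^sub>2 r\<^sup>T\<close> with \<open>r\<^sup>T = (c / n) e\<^sub>2\<^sup>T M\<^sub>2\<close>. So the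
  \<open>4 \<times> 4\<close> matrix \<open>A\<close> with the rows of \<open>M\<^sub>1\<close> and the fourth row \<open>r\<^sup>T\<close> satisfies
  \<open>[I, 0] A = M\<^sub>1\<close> and \<open>[H, e\<^sub>2] A = c M\<^sub>2\<close>. Its kernel consists of the vectors killed by both
  \<open>M\<^sub>1\<close> and \<open>M\<^sub>2\<close>, so it is trivial because the two centers are distinct, and \<open>A\<close> is the required
  projective transformation (lemma \<open>theta2_equivalent_canonical_pair\<close>).

  If \<open>(N\<^sub>1, N\<^sub>2)\<close> has the same \<open>F\<close>, the identity shows that both second epipoles are
  orthogonal to the range of \<open>F\<close>, which is two-dimensional; so they agree up to a scalar
  (lemma \<open>fundamental_matrix_determines_epipole\<close>). The normal form is built from \<open>F\<close> and any
  coordinate vector of the epipole, so both pairs have the same one.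
\<close>

section \<open>Matrices up to scalars, inverses, and rank\<close>

lemma map_matrix_scale_vector_mult:
  fixes A :: "'a::comm_semiring_1^'n^'m"
  shows "map_matrix ((*) c) A *v x = c *s (A *v x)"
  by (simp add: vec_eq_iff matrix_vector_mult_def sum_distrib_left mult.assoc)

lemma map_matrix_scale_mult_left:
  fixes A :: "'a::comm_semiring_1^'n^'m"
  shows "map_matrix ((*) c) A ** B = map_matrix ((*) c) (A ** B)"
  by (simp add: vec_eq_iff matrix_matrix_mult_def sum_distrib_left mult.assoc)

lemma map_matrix_scale_scale:
  fixes A :: "'a::comm_semiring_1^'n^'m"
  shows "map_matrix ((*) c) (map_matrix ((*) d) A) = map_matrix ((*) (c * d)) A"
  by (simp add: vec_eq_iff mult.assoc)

lemma map_matrix_scale_one: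
  fixes A :: "'a::comm_semiring_1^'n^'m"
  shows "map_matrix ((*) 1) A = A"
  by (simp add: vec_eq_iff)

lemma matrix_inv_mult:
  assumes "invertible A"
  shows "A ** matrix_inv A = mat 1" "matrix_inv A ** A = mat 1"
  using assms someI_ex[of "\<lambda>B. A ** B = mat 1 \<and> B ** A = mat 1"]
  by (auto simp: invertible_def matrix_inv_def)

text \<open>
  The rank is the dimension of the span of the set of rows, so full rank forces the
  rows to be pairwise distinct as well as independent; distinctness is what turns independence
  of the set into independence of the family.
\<close>

lemma full_row_rank_surj:
  fixes A :: "'a::field^'n^'m"
  assumes "rank A = CARD('m)"
  shows "surj ((*v) A)"
proof -
  let ?f = "\<lambda>i. row i A"
  have rows: "rows A = range ?f"
    by (auto simp: rows_def)
  have fin: "finite (range ?f)"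
    by simp
  have dim: "vec.dim (range ?f) = CARD('m)"
    using assms rows by (simp add: row_rank_def_gen)
  have le: "card (range ?f) \<le> CARD('m)"
    by (rule card_image_le) simp
  moreover have "CARD('m) \<le> card (range ?f)"
    using vec.dim_le_card'[OF fin] dim by simp
  ultimately have inj: "inj ?f"
    by (simp add: eq_card_imp_inj_on)
  have indep: "vec.independent (range ?f)"
    by (rule vec.card_le_dim_spanning[OF order_refl vec.span_superset fin]) (use le dim in simp)
  have "c i = 0" if sum: "(\<Sum>i\<in>UNIV. c i *s row i A) = 0" for c :: "'m \<Rightarrow> 'a" and i
  proof -
    have "(\<Sum>v\<in>range ?f. c (inv ?f v) *s v) = 0"
      using sum by (simp add: sum.reindex[OF inj] inv_f_f[OF inj])
    then have "c (inv ?f (?f i)) = 0"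
      by (rule vec.independentD[OF indep fin order_refl]) simp
    then show ?thesis
      by (simp add: inv_f_f[OF inj])
  qed
  then show ?thesis
    unfolding matrix_right_invertible_surjective[symmetric] matrix_right_invertible_independent_rows
    by blast
qed

text \<open>
  A right inverse \<open>R\<close> embeds the target as a hyperplane complementary to the kernel. Projecting
  any point off this hyperplane along it gives a generator \<open>C\<close> of the kernel.
\<close>

lemma surj_kernel_is_line:
  fixes A :: "'a::field^'n^'m"
  assumes surj: "surj ((*v) A)" and card: "CARD('n) = CARD('m) + 1"
  obtains C where "C \<noteq> 0" "{x. A *v x = 0} = vec.span {C}"
proof -
  obtain R where R: "A ** R = mat 1"
    using surj matrix_right_invertible_surjective by blast
  then have AR: "A *v (R *v y) = y" for y
    by (simp add: matrix_vector_mul_assoc)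
  have lin: "Vector_Spaces.linear (*s) (*s) ((*v) R)"
    by (rule matrix_vector_mul_linear_gen)
  have "inj ((*v) R)"
    by (metis AR injI)
  then have dim: "vec.dim (range ((*v) R)) = CARD('m)"
    using vec.dim_image_eq[OF lin, of UNIV] by (simp add: vec_dim_card del: vec.dim_UNIV)
  have span: "vec.span (range ((*v) R)) = range ((*v) R)"
    using vec.span_image[of R UNIV] by (simp add: vec.span_UNIV)
  have "range ((*v) R) \<noteq> UNIV"
    using dim card vec_dim_card[where 'a='a and 'n='n] by auto
  then obtain y where y: "y \<notin> range ((*v) R)"
    by blast
  define C where "C = y - R *v (A *v y)"
  have AC: "A *v C = 0"
    by (simp add: C_def matrix_vector_mult_diff_distrib AR)
  have C: "C \<notin> range ((*v) R)"
  proof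
    assume "C \<in> range ((*v) R)"
    then obtain z where "C = R *v z" by blast
    then have "y = R *v (z + A *v y)"
      by (simp add: C_def matrix_vector_right_distrib algebra_simps)
    then show False using y by blast
  qed
  have "vec.dim (insert C (range ((*v) R))) = CARD('n)"
    using C by (simp add: vec.dim_insert span dim card)
  then have full: "vec.span (insert C (range ((*v) R))) = UNIV"
    using vec.dim_eq_full vec_dim_card vec.dim_UNIV vec.dimension_def by metis
  have "x \<in> vec.span {C}" if "A *v x = 0" for x
  proof -
    have "x \<in> {x. \<exists>k. x - k *s C \<in> range ((*v) R)}"
      using full by (simp add: vec.span_insert span)
    then obtain k z where "x - k *s C = R *v z"
      by blast
    moreover from this have "z = 0"
      using AR[of z] that AC
      by (metis diff_zero matrix_vector_mult_diff_distrib vector_scalar_commute vector_smult_rzero)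
    ultimately have "x = k *s C"
      by simp
    then show ?thesis
      by (auto simp: vec.span_singleton)
  qed
  then have "{x. A *v x = 0} = vec.span {C}"
    using AC by (auto simp: vec.span_singleton vector_scalar_commute)
  moreover have "C \<noteq> 0"
    using C span vec.span_zero by metis
  ultimately show thesis
    using that by blast
qed

section \<open>Projections and their centers\<close>

lemma vec_proj_eq_refl: "vec_proj_eq x x"
  unfolding vec_proj_eq_def by (rule exI[of _ 1]) simp

lemma projection_matrix_surj: "projection_matrix M \<Longrightarrow> surj ((*v) M)"
  by (rule full_row_rank_surj) (simp add: projection_matrix_def)

lemma projection_matrix_center:
  assumes "projection_matrix M"
  obtains C where "is_center M C"
  using surj_kernel_is_line[OF projection_matrix_surj[OF assms]] by (auto simp: is_center_def)

lemma is_center_kernel_iff: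
  assumes "is_center M C"
  shows "M *v P = 0 \<longleftrightarrow> (\<exists>t. P = t *s C)"
proof -
  have "P \<in> {P. M *v P = 0} \<longleftrightarrow> P \<in> vec.span {C}"
    using assms by (simp add: is_center_def)
  then show ?thesis
    by (auto simp: vec.span_singleton)
qed

section \<open>The scalar product and the cross product over the complex numbers\<close>

lemma cross_matrix_mult_vector:
  "(cross_matrix x *v y) $ 1 = x$2 * y$3 - x$3 * y$2"
  "(cross_matrix x *v y) $ 2 = x$3 * y$1 - x$1 * y$3"
  "(cross_matrix x *v y) $ 3 = x$1 * y$2 - x$2 * y$1"
  by (simp_all add: cross_matrix_def matrix_vector_mult_def sum_3)

lemma scalar_product_scale_right:
  fixes x y :: "'a::comm_semiring_1^'n"
  shows "scalar_product x (c *s y) = c * scalar_product x y"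
  by (simp add: scalar_product_def sum_distrib_left mult.left_commute)

lemma scalar_product_scale_left:
  fixes x y :: "'a::comm_semiring_1^'n"
  shows "scalar_product (c *s x) y = c * scalar_product x y"
  by (simp add: scalar_product_def sum_distrib_left mult.assoc)

lemma scalar_product_transpose:
  fixes A :: "'a::comm_semiring_1^'n^'m"
  shows "scalar_product (transpose A *v x) y = scalar_product x (A *v y)"
proof -
  have "scalar_product (transpose A *v x) y = (\<Sum>j\<in>UNIV. \<Sum>i\<in>UNIV. A $ i $ j * x $ i * y $ j)"
    by (simp add: scalar_product_def transpose_def matrix_vector_mult_def sum_distrib_right)
  also have "\<dots> = (\<Sum>i\<in>UNIV. \<Sum>j\<in>UNIV. A $ i $ j * x $ i * y $ j)"
    by (rule sum.swap)
  also have "\<dots> = scalar_product x (A *v y)"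
    by (simp add: scalar_product_def matrix_vector_mult_def sum_distrib_left mult.assoc
        mult.left_commute)
  finally show ?thesis .
qed

lemma scalar_product_3: "scalar_product x y = x$1 * y$1 + x$2 * y$2 + x$3 * y$3"
  for x y :: "'a::semiring_1^3"
  by (simp add: scalar_product_def sum_3)

lemma scalar_product_axis: "scalar_product x (axis i 1) = x $ i"
  for x :: "'a::semiring_1^'n"
  by (simp add: scalar_product_def axis_def if_distrib cong: if_cong)

lemma cross_matrix_self: "cross_matrix x *v x = 0"
  by (simp add: vec_eq_iff forall_3 cross_matrix_mult_vector)

lemma scalar_product_cross: "scalar_product x (cross_matrix x *v y) = 0"
  by (simp add: scalar_product_3 cross_matrix_mult_vector algebra_simps)

lemma scalar_product_cross_swap:
  "scalar_product x (cross_matrix y *v z) = - scalar_product (cross_matrix y *v x) z"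
  by (simp add: scalar_product_3 cross_matrix_mult_vector algebra_simps)

lemma cross_cross:
  "cross_matrix x *v (cross_matrix y *v z) = scalar_product x z *s y - scalar_product x y *s z"
  by (simp add: vec_eq_iff forall_3 cross_matrix_mult_vector scalar_product_3 algebra_simps)

lemma cross_matrix_eq_0_imp_parallel:
  assumes "cross_matrix x *v y = 0" "x \<noteq> 0"
  obtains c where "y = c *s x"
proof -
  have eqs: "x$2 * y$3 = x$3 * y$2" "x$3 * y$1 = x$1 * y$3" "x$1 * y$2 = x$2 * y$1"
    using assms(1) by (simp_all add: vec_eq_iff forall_3 cross_matrix_mult_vector)
  obtain i where i: "x $ i \<noteq> 0"
    using assms(2) by (auto simp: vec_eq_iff)
  have "x $ i * y $ j = y $ i * x $ j" for i j
    using exhaust_3[of i] exhaust_3[of j] eqs by (auto simp: algebra_simps)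
  then have "y = (y $ i / x $ i) *s x"
    using i by (simp add: vec_eq_iff field_simps)
  then show thesis ..
qed

text \<open>
  If all \<open>x \<times> y\<close> were multiples of one \<open>w\<close>, then \<open>w \<times> (x \<times> y) = 0\<close> would make \<open>(w \<cdot> x) y\<close> a
  multiple of \<open>x\<close> for every \<open>y\<close>, hence \<open>w \<cdot> x = 0\<close> and then \<open>w = 0\<close>. But not every
  \<open>x \<times> y\<close> vanishes.
\<close>

lemma cross_matrix_not_rank_one:
  assumes "x \<noteq> 0"
  shows "\<exists>y. \<forall>c. cross_matrix x *v y \<noteq> c *s w"
proof (rule ccontr)
  assume "\<not> ?thesis"
  then have "\<forall>y. \<exists>c. cross_matrix x *v y = c *s w" by blast
  then obtain f where f: "cross_matrix x *v y = f y *s w" for y by metis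
  have "cross_matrix w *v (cross_matrix x *v y) = 0" for y
    by (simp add: f vector_scalar_commute cross_matrix_self)
  then have eq: "scalar_product w y *s x = scalar_product w x *s y" for y
    by (simp add: cross_cross)
  obtain y where y: "cross_matrix x *v y \<noteq> 0"
  proof -
    have "\<not> (cross_matrix x *v axis 1 1 = 0 \<and> cross_matrix x *v axis 2 1 = 0)"
      using assms by (auto simp: vec_eq_iff forall_3 cross_matrix_mult_vector axis_def)
    then show thesis
      using that by blast
  qed
  have "scalar_product w x *s (cross_matrix x *v y) = 0"
    by (metis eq cross_matrix_self vector_scalar_commute vector_smult_rzero)
  then have "scalar_product w x = 0"
    using y by simp
  then have "scalar_product w z = 0" for z
    using eq[of z] assms by simp
  then have "w $ i = 0" for i
    by (metis scalar_product_axis)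
  then have "w = 0"
    by (simp add: vec_eq_iff)
  then show False
    using f[of y] y by simp
qed

section \<open>Pointwise proportional matrices\<close>

text \<open>
  Comparing \<open>L (P + Q)\<close> with \<open>L P + L Q\<close> shows that the factors at \<open>P\<close> and \<open>Q\<close> agree when \<open>K P\<close>
  and \<open>K Q\<close> are independent. When they are dependent, a third point, whose image is
  independent of both, mediates; it exists because the rank of \<open>K\<close> is at least two. That \<open>L\<close>
  vanishes on the kernel of \<open>K\<close> follows by shifting to points outside the kernel.
\<close>

lemma proportional_if_pointwise_proportional:
  fixes K L :: "'a::field^'n^'m"
  assumes ptw: "\<And>P. K *v P \<noteq> 0 \<Longrightarrow> \<exists>c. c \<noteq> 0 \<and> L *v P = c *s (K *v P)"
    and rank: "\<And>w. \<exists>P. \<forall>c. K *v P \<noteq> c *s w"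
  obtains c where "c \<noteq> 0" "L = map_matrix ((*) c) K"
proof -
  have "\<forall>P. \<exists>c. K *v P \<noteq> 0 \<longrightarrow> c \<noteq> 0 \<and> L *v P = c *s (K *v P)"
    using ptw by blast
  then obtain l where l: "K *v P \<noteq> 0 \<Longrightarrow> l P \<noteq> 0 \<and> L *v P = l P *s (K *v P)" for P
    by metis
  have indep: "l P = l Q" if P: "K *v P \<noteq> 0" and Q: "\<And>c. K *v Q \<noteq> c *s (K *v P)" for P Q
  proof -
    have Q0: "K *v Q \<noteq> 0"
      using Q[of 0] by simp
    \<comment> \<open>The factor at \<open>P + Q\<close> is meaningful as well, and it will turn out to equal both others.\<close>
    have "K *v (P + Q) \<noteq> 0"
      using Q[of "-1"] by (auto simp: matrix_vector_right_distrib add_eq_0_iff)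
    then have "l (P + Q) *s (K *v P + K *v Q) = l P *s (K *v P) + l Q *s (K *v Q)"
      using l[of "P + Q"] l[OF P] l[OF Q0] by (simp add: matrix_vector_right_distrib)
    then have eq: "(l (P + Q) - l Q) *s (K *v Q) = (l P - l (P + Q)) *s (K *v P)"
      by (simp add: vec_eq_iff algebra_simps)
    have "l (P + Q) = l Q"
    proof (rule ccontr)
      assume ne: "l (P + Q) \<noteq> l Q"
      have "K *v Q = (1 / (l (P + Q) - l Q)) *s ((l (P + Q) - l Q) *s (K *v Q))"
        using ne by (simp only: vector_smult_assoc) simp
      also have "\<dots> = ((l P - l (P + Q)) / (l (P + Q) - l Q)) *s (K *v P)"
        unfolding eq by (simp only: vector_smult_assoc) simp
      finally show False
        using Q by blast
    qed
    then show ?thesis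
      using eq P by auto
  qed
  have const: "l P = l P'" if P: "K *v P \<noteq> 0" and P': "K *v P' \<noteq> 0" for P P'
  proof (cases "\<exists>c. K *v P' = c *s (K *v P)")
    case True
    then obtain c where c: "K *v P' = c *s (K *v P)" ..
    obtain Q where Q: "\<And>d. K *v Q \<noteq> d *s (K *v P)"
      using rank by blast
    have Q': "K *v Q \<noteq> d *s (K *v P')" for d
      using Q c by (simp add: vector_smult_assoc)
    show ?thesis
      using indep[OF P Q] indep[OF P' Q'] by simp
  next
    case False
    then show ?thesis
      using indep[OF P] by blast
  qed
  obtain Q where Q: "K *v Q \<noteq> 0"
    using rank[of 0] by auto
  have "L *v P = l Q *s (K *v P)" for P
  proof (cases "K *v P = 0")
    case True
    then have "K *v (P + Q) = K *v Q"
      by (simp add: matrix_vector_right_distrib)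
    then have "L *v (P + Q) = L *v Q"
      using l[of "P + Q"] l[OF Q] const[of "P + Q" Q] Q by simp
    then show ?thesis
      using True by (simp add: matrix_vector_right_distrib)
  next
    case False
    then show ?thesis
      using l const[OF False Q] by simp
  qed
  then have "L = map_matrix ((*) (l Q)) K"
    by (simp add: matrix_eq map_matrix_scale_vector_mult)
  then show thesis
    using that l[OF Q] by blast
qed

section \<open>The identity satisfied by the fundamental matrix\<close>

text \<open>
  The line \<open>F M\<^sub>1 P\<close> contains the image of \<open>P\<close> and the second epipole \<open>M\<^sub>2 C\<close>. The center \<open>C\<close> itself
  is not in the preimage of \<open>M\<^sub>1 P\<close>, but \<open>P\<close> and \<open>P + C\<close> are, and \<open>M\<^sub>2 C\<close> is the difference of
  their images.
\<close>

lemma fundamental_matrix_orthogonal: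
  assumes F: "is_fundamental_matrix M\<^sub>1 M\<^sub>2 F" and C: "is_center M\<^sub>1 C"
    and p: "M\<^sub>1 *v P \<noteq> 0" "\<not> is_epipole M\<^sub>1 M\<^sub>2 (M\<^sub>1 *v P)"
  shows "F *v (M\<^sub>1 *v P) \<noteq> 0"
    and "scalar_product (F *v (M\<^sub>1 *v P)) (M\<^sub>2 *v P) = 0"
    and "scalar_product (F *v (M\<^sub>1 *v P)) (M\<^sub>2 *v C) = 0"
proof -
  let ?S = "(*v) M\<^sub>2 ` preimage_point M\<^sub>1 (M\<^sub>1 *v P)"
  have line: "is_line_coords (F *v (M\<^sub>1 *v P)) ?S"
    using F p by (simp add: is_fundamental_matrix_def)
  then show "F *v (M\<^sub>1 *v P) \<noteq> 0"
    by (simp add: is_line_coords_def)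
  have "M\<^sub>1 *v C = 0"
    using is_center_kernel_iff[OF C] by (metis vector_smult_lid)
  then have pre: "Q \<in> preimage_point M\<^sub>1 (M\<^sub>1 *v P)" if "Q = P \<or> Q = P + C" for Q
  proof -
    have "M\<^sub>1 *v Q = M\<^sub>1 *v P"
      using that \<open>M\<^sub>1 *v C = 0\<close> by (auto simp: matrix_vector_right_distrib)
    moreover from this have "Q \<noteq> 0"
      using p(1) by auto
    ultimately show ?thesis
      by (simp add: preimage_point_def vec_proj_eq_refl)
  qed
  have span: "M\<^sub>2 *v P \<in> vec.span ?S" "M\<^sub>2 *v (P + C) \<in> vec.span ?S"
    using pre by (blast intro: vec.span_base)+
  then have "M\<^sub>2 *v C \<in> vec.span ?S"
    using vec.span_diff[OF span(2) span(1)] by (simp add: matrix_vector_right_distrib)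
  with span(1) line
  show "scalar_product (F *v (M\<^sub>1 *v P)) (M\<^sub>2 *v P) = 0"
    and "scalar_product (F *v (M\<^sub>1 *v P)) (M\<^sub>2 *v C) = 0"
    by (auto simp: is_line_coords_def)
qed

text \<open>
  The defining property of a fundamental matrix says nothing at the first epipole. The points of
  space projected there by \<open>M\<^sub>1\<close> lie on the line joining the centers, which \<open>M\<^sub>2\<close> maps to multiples
  of \<open>M\<^sub>2 C\<close>, so a nonzero cross product excludes them.
\<close>

lemma not_epipole_if_cross_nonzero:
  assumes C: "is_center M\<^sub>1 C" and K: "cross_matrix (M\<^sub>2 *v C) *v (M\<^sub>2 *v P) \<noteq> 0"
  shows "M\<^sub>1 *v P \<noteq> 0" and "\<not> is_epipole M\<^sub>1 M\<^sub>2 (M\<^sub>1 *v P)"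
proof -
  show "M\<^sub>1 *v P \<noteq> 0"
    using K by (auto simp: is_center_kernel_iff[OF C] vector_scalar_commute cross_matrix_self)
  show "\<not> is_epipole M\<^sub>1 M\<^sub>2 (M\<^sub>1 *v P)"
  proof
    assume "is_epipole M\<^sub>1 M\<^sub>2 (M\<^sub>1 *v P)"
    then obtain D k where D: "is_center M\<^sub>2 D" and k: "M\<^sub>1 *v P = k *s (M\<^sub>1 *v D)"
      by (auto simp: is_epipole_def vec_proj_eq_def)
    have "M\<^sub>1 *v (P - k *s D) = 0"
      by (simp add: k matrix_vector_mult_diff_distrib vector_scalar_commute)
    then obtain t where t: "P - k *s D = t *s C"
      using is_center_kernel_iff[OF C] by blast
    have "M\<^sub>2 *v D = 0"
      using is_center_kernel_iff[OF D] by (metis vector_smult_lid)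
    then have "M\<^sub>2 *v P = M\<^sub>2 *v (P - k *s D)"
      by (simp add: matrix_vector_mult_diff_distrib vector_scalar_commute)
    also have "\<dots> = t *s (M\<^sub>2 *v C)"
      by (simp add: t vector_scalar_commute)
    finally show False
      using K by (simp add: vector_scalar_commute cross_matrix_self)
  qed
qed

text \<open>
  Pulled back to space by \<open>M\<^sub>1\<close>, the fundamental matrix becomes the map that joins the image under
  \<open>M\<^sub>2\<close> to the second epipole: both lines pass through \<open>M\<^sub>2 P\<close> and \<open>e\<close>, and
  \<open>cross_matrix_not_rank_one\<close> supplies the rank needed for a constant factor.
\<close>

lemma fundamental_matrix_times_projection:
  assumes M2: "projection_matrix M\<^sub>2" and F: "is_fundamental_matrix M\<^sub>1 M\<^sub>2 F"
    and e: "is_epipole M\<^sub>2 M\<^sub>1 e" "e \<noteq> 0"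
  obtains c where "c \<noteq> 0" "F ** M\<^sub>1 = map_matrix ((*) c) (cross_matrix e ** M\<^sub>2)"
proof -
  obtain C k where C: "is_center M\<^sub>1 C" and k: "k \<noteq> 0" "e = k *s (M\<^sub>2 *v C)"
    using e by (auto simp: is_epipole_def vec_proj_eq_def)
  let ?K = "cross_matrix e ** M\<^sub>2"
  have ptw: "\<exists>c. c \<noteq> 0 \<and> (F ** M\<^sub>1) *v P = c *s (?K *v P)" if "?K *v P \<noteq> 0" for P
  proof -
    let ?l = "F *v (M\<^sub>1 *v P)" and ?q = "M\<^sub>2 *v P"
    have K: "cross_matrix e *v ?q \<noteq> 0"
      using that by (simp add: matrix_vector_mul_assoc)
    then have "cross_matrix (M\<^sub>2 *v C) *v ?q \<noteq> 0"
      by (auto simp: k vec_eq_iff forall_3 cross_matrix_mult_vector algebra_simps)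
    note ne = not_epipole_if_cross_nonzero[OF C this]
    note orth = fundamental_matrix_orthogonal[OF F C ne]
    have "scalar_product ?l e = 0"
      using orth(3) by (simp add: k scalar_product_scale_right)
    \<comment> \<open>\<open>l\<close> and \<open>e \<times> q\<close> are both orthogonal to \<open>e\<close> and \<open>q\<close>, hence parallel.\<close>
    then have "cross_matrix ?l *v (cross_matrix e *v ?q) = 0"
      by (simp add: cross_cross orth(2))
    then have "cross_matrix (cross_matrix e *v ?q) *v ?l = 0"
      by (simp add: vec_eq_iff forall_3 cross_matrix_mult_vector algebra_simps)
    then obtain c where "?l = c *s (cross_matrix e *v ?q)"
      using cross_matrix_eq_0_imp_parallel K by blast
    then show ?thesis
      using orth(1) by (auto simp: matrix_vector_mul_assoc)
  qed
  have rank: "\<exists>P. \<forall>c. ?K *v P \<noteq> c *s w" for w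
  proof -
    obtain y where y: "\<forall>c. cross_matrix e *v y \<noteq> c *s w"
      using cross_matrix_not_rank_one[OF e(2)] by blast
    obtain P where "y = M\<^sub>2 *v P"
      using projection_matrix_surj[OF M2] by (metis surjD)
    with y show ?thesis
      by (auto simp: matrix_vector_mul_assoc)
  qed
  show thesis
    using proportional_if_pointwise_proportional[OF ptw rank] that by blast
qed

text \<open>
  By the identity for \<open>(N\<^sub>1, N\<^sub>2)\<close>, \<open>e'\<close> is orthogonal to the range of \<open>F\<close>. By the identity for
  \<open>(M\<^sub>1, M\<^sub>2)\<close> and surjectivity of \<open>M\<^sub>2\<close>, this range contains all \<open>e \<times> y\<close>. So \<open>e \<times> e'\<close> is
  orthogonal to every \<open>y\<close>, and \<open>e'\<close> is parallel to \<open>e\<close>.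
\<close>

lemma fundamental_matrix_determines_epipole:
  assumes M2: "projection_matrix M\<^sub>2"
    and F: "is_fundamental_matrix M\<^sub>1 M\<^sub>2 F" and e: "is_epipole M\<^sub>2 M\<^sub>1 e" "e \<noteq> 0"
    and N1: "projection_matrix N\<^sub>1" and N2: "projection_matrix N\<^sub>2"
    and F': "is_fundamental_matrix N\<^sub>1 N\<^sub>2 F" and e': "is_epipole N\<^sub>2 N\<^sub>1 e'" "e' \<noteq> 0"
  shows "is_epipole N\<^sub>2 N\<^sub>1 e"
proof -
  obtain c where c: "c \<noteq> 0" "F ** M\<^sub>1 = map_matrix ((*) c) (cross_matrix e ** M\<^sub>2)"
    using fundamental_matrix_times_projection[OF M2 F e] .
  obtain d where d: "d \<noteq> 0" "F ** N\<^sub>1 = map_matrix ((*) d) (cross_matrix e' ** N\<^sub>2)"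
    using fundamental_matrix_times_projection[OF N2 F' e'] .
  have Fe': "scalar_product e' (F *v p) = 0" for p
  proof -
    obtain P where "p = N\<^sub>1 *v P"
      using projection_matrix_surj[OF N1] by (metis surjD)
    then have "F *v p = (F ** N\<^sub>1) *v P"
      by (simp add: matrix_vector_mul_assoc)
    also have "\<dots> = cross_matrix e' *v (d *s (N\<^sub>2 *v P))"
      by (simp add: d map_matrix_scale_vector_mult vector_scalar_commute matrix_vector_mul_assoc)
    finally show ?thesis
      by (simp add: scalar_product_cross)
  qed
  have "scalar_product (cross_matrix e *v e') y = 0" for y
  proof -
    obtain P where "(1 / c) *s y = M\<^sub>2 *v P"
      using projection_matrix_surj[OF M2] by (metis surjD)
    then have y: "y = c *s (M\<^sub>2 *v P)"
      using c(1) by (simp add: vec_eq_iff field_simps)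
    have "cross_matrix e *v y = (F ** M\<^sub>1) *v P"
      by (simp add: y c map_matrix_scale_vector_mult vector_scalar_commute matrix_vector_mul_assoc)
    also have "\<dots> = F *v (M\<^sub>1 *v P)"
      by (simp add: matrix_vector_mul_assoc)
    finally show ?thesis
      using Fe' scalar_product_cross_swap[of e' e y] by simp
  qed
  then have "cross_matrix e *v e' = 0"
    by (metis scalar_product_axis vec_eq_iff zero_index)
  then obtain t where t: "e' = t *s e"
    using cross_matrix_eq_0_imp_parallel e(2) by blast
  then have "t \<noteq> 0"
    using e' by auto
  obtain C k where C: "is_center N\<^sub>1 C" and k: "k \<noteq> 0" "e' = k *s (N\<^sub>2 *v C)"
    using e' by (auto simp: is_epipole_def vec_proj_eq_def)
  have "e = (k / t) *s (N\<^sub>2 *v C)"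
    using t k(2) \<open>t \<noteq> 0\<close> by (simp add: vec_eq_iff field_simps)
  then show ?thesis
    using C k(1) \<open>t \<noteq> 0\<close>
    by (auto simp: is_epipole_def vec_proj_eq_def intro!: exI[of _ C] exI[of _ "k / t"])
qed

section \<open>Equivalence under projective transformations of space\<close>

text \<open>
  Moving the inverse to the other side replaces \<open>matrix_inv\<close>, a choice operator, by products, which
  are easy to exhibit and to compose.
\<close>

lemma theta2_equivalent_iff:
  "theta2_equivalent (M\<^sub>1, M\<^sub>2) (N\<^sub>1, N\<^sub>2) \<longleftrightarrow>
     (\<exists>A a b. invertible A \<and> a \<noteq> 0 \<and> b \<noteq> 0 \<and>
        M\<^sub>1 = map_matrix ((*) a) (N\<^sub>1 ** A) \<and> M\<^sub>2 = map_matrix ((*) b) (N\<^sub>2 ** A))"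
proof -
  have "M ** matrix_inv A = map_matrix ((*) a) N \<longleftrightarrow> M = map_matrix ((*) a) (N ** A)"
    if "invertible A" for M N :: "complex^4^3" and A a
    by (metis map_matrix_scale_mult_left matrix_inv_mult[OF that] matrix_mul_assoc matrix_mul_rid)
  then show ?thesis
    by (auto simp: theta2_equivalent_def theta2_def mat_proj_eq_def) blast+
qed

lemma theta2_equivalent_common_target:
  assumes "theta2_equivalent (M\<^sub>1, M\<^sub>2) (K\<^sub>1, K\<^sub>2)" "theta2_equivalent (N\<^sub>1, N\<^sub>2) (K\<^sub>1, K\<^sub>2)"
  shows "theta2_equivalent (M\<^sub>1, M\<^sub>2) (N\<^sub>1, N\<^sub>2)"
proof -
  obtain A a b where A: "invertible A" "a \<noteq> 0" "b \<noteq> 0"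
      "M\<^sub>1 = map_matrix ((*) a) (K\<^sub>1 ** A)" "M\<^sub>2 = map_matrix ((*) b) (K\<^sub>2 ** A)"
    using assms(1) by (auto simp: theta2_equivalent_iff)
  obtain B c d where B: "invertible B" "c \<noteq> 0" "d \<noteq> 0"
      "N\<^sub>1 = map_matrix ((*) c) (K\<^sub>1 ** B)" "N\<^sub>2 = map_matrix ((*) d) (K\<^sub>2 ** B)"
    using assms(2) by (auto simp: theta2_equivalent_iff)
  let ?D = "matrix_inv B ** A"
  have cancel: "(K ** B) ** ?D = K ** A" for K :: "complex^4^3"
    by (metis matrix_inv_mult(1)[OF B(1)] matrix_mul_assoc matrix_mul_lid)
  have "invertible (matrix_inv B)"
    using matrix_inv_mult[OF B(1)] by (auto simp: invertible_def)
  then have "invertible ?D"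
    using A(1) by (rule invertible_mult)
  moreover have "M\<^sub>1 = map_matrix ((*) (a / c)) (N\<^sub>1 ** ?D)"
    using B(2) by (simp add: A(4) B(4) map_matrix_scale_mult_left map_matrix_scale_scale cancel)
  moreover have "M\<^sub>2 = map_matrix ((*) (b / d)) (N\<^sub>2 ** ?D)"
    using B(3) by (simp add: A(5) B(5) map_matrix_scale_mult_left map_matrix_scale_scale cancel)
  ultimately show ?thesis
    unfolding theta2_equivalent_iff using A(2,3) B(2,3) by (metis divide_eq_0_iff)
qed

section \<open>The normal form\<close>

lemma vector_4 [simp]:
  "(vector [x, y, z, w] :: 'a::zero^4) $ 1 = x"
  "(vector [x, y, z, w] :: 'a::zero^4) $ 2 = y"
  "(vector [x, y, z, w] :: 'a::zero^4) $ 3 = z"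
  "(vector [x, y, z, w] :: 'a::zero^4) $ 4 = w"
  by (simp_all add: vector_def)

definition append_row :: "complex^4^3 \<Rightarrow> complex^4 \<Rightarrow> complex^4^4" where
  "append_row M r = vector [M$1, M$2, M$3, r]"

lemma append_column_mult_append_row:
  "(append_column X v ** append_row M r) *v P = X *v (M *v P) + scalar_product r P *s v"
  by (simp add: vec_eq_iff append_column_def append_row_def matrix_vector_mult_def
      matrix_matrix_mult_def scalar_product_def sum_3 sum_4 algebra_simps)

text \<open>
  The fourth row \<open>r\<close> is the row vector \<open>(c / n) e\<^sup>T M\<^sub>2\<close>, where \<open>n = e\<^sup>T e\<close>: it is forced by requiring
  that \<open>e r\<^sup>T\<close> be the difference between \<open>c M\<^sub>2\<close> and \<open>H M\<^sub>1\<close>.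
\<close>

lemma theta2_equivalent_canonical_pair:
  assumes M2: "projection_matrix M\<^sub>2" and F: "is_fundamental_matrix M\<^sub>1 M\<^sub>2 F"
    and e: "is_epipole M\<^sub>2 M\<^sub>1 e" "scalar_product e e \<noteq> 0"
  defines "H \<equiv> map_matrix ((*) (- 1 / scalar_product e e)) (cross_matrix e) ** F"
  shows "theta2_equivalent (M\<^sub>1, M\<^sub>2) (append_column (mat 1) 0, append_column H e)"
proof -
  let ?n = "scalar_product e e"
  have e0: "e \<noteq> 0"
    using e(2) by (auto simp: scalar_product_def)
  obtain C k where C: "is_center M\<^sub>1 C" and k: "e = k *s (M\<^sub>2 *v C)"
    using e by (auto simp: is_epipole_def vec_proj_eq_def)
  obtain c where c: "c \<noteq> 0" "F ** M\<^sub>1 = map_matrix ((*) c) (cross_matrix e ** M\<^sub>2)"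
    using fundamental_matrix_times_projection[OF M2 F e(1) e0] .
  define r where "r = (c / ?n) *s (transpose M\<^sub>2 *v e)"
  define A where "A = append_row M\<^sub>1 r"
  have r: "scalar_product r P = (c / ?n) * scalar_product e (M\<^sub>2 *v P)" for P
    by (simp only: r_def scalar_product_scale_left scalar_product_transpose)
  have H: "H *v (M\<^sub>1 *v P) = c *s (M\<^sub>2 *v P) - scalar_product r P *s e" for P
  proof -
    have "F *v (M\<^sub>1 *v P) = c *s (cross_matrix e *v (M\<^sub>2 *v P))"
      by (simp add: matrix_vector_mul_assoc c map_matrix_scale_vector_mult)
    then have "H *v (M\<^sub>1 *v P) =
        (- 1 / ?n) *s (c *s (cross_matrix e *v (cross_matrix e *v (M\<^sub>2 *v P))))"
      by (simp add: H_def map_matrix_scale_vector_mult vector_scalar_commute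
          flip: matrix_vector_mul_assoc)
    also have "\<dots> = c *s (M\<^sub>2 *v P) - scalar_product r P *s e"
      using e(2) by (simp add: cross_cross r vec_eq_iff field_simps)
    finally show ?thesis .
  qed
  have M1A: "append_column (mat 1) 0 ** A = M\<^sub>1"
    by (simp add: matrix_eq A_def append_column_mult_append_row)
  have M2A: "append_column H e ** A = map_matrix ((*) c) M\<^sub>2"
    by (simp add: matrix_eq A_def append_column_mult_append_row H map_matrix_scale_vector_mult)
  \<comment> \<open>A vector in the kernel of \<open>A\<close> lies in the kernels of \<open>M\<^sub>1\<close> and \<open>M\<^sub>2\<close>, so it is a multiple of
    the first center, at which \<open>M\<^sub>2\<close> does not vanish because \<open>e \<noteq> 0\<close>.\<close>
  have "P = 0" if "A *v P = 0" for P
  proof -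
    have "M\<^sub>1 *v P = 0"
      using that M1A by (metis matrix_vector_mul_assoc matrix_vector_mult_0_right)
    then obtain t where t: "P = t *s C"
      using is_center_kernel_iff[OF C] by blast
    have "c *s (M\<^sub>2 *v P) = 0"
      using that M2A
      by (metis map_matrix_scale_vector_mult matrix_vector_mul_assoc matrix_vector_mult_0_right)
    then have "t *s e = 0"
      using c(1) by (auto simp: t k vector_scalar_commute)
    then show ?thesis
      using e0 t by simp
  qed
  then have "invertible A"
    unfolding invertible_left_inverse matrix_left_invertible_ker by blast
  moreover have "M\<^sub>1 = map_matrix ((*) 1) (append_column (mat 1) 0 ** A)"
    by (simp only: M1A map_matrix_scale_one)
  moreover have "M\<^sub>2 = map_matrix ((*) (1 / c)) (append_column H e ** A)"
    using c(1) by (simp add: M2A map_matrix_scale_scale map_matrix_scale_one)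
  ultimately show ?thesis
    unfolding theta2_equivalent_iff using c(1) by (metis divide_eq_0_iff zero_neq_one)
qed

theorem proposition1:
  fixes M\<^sub>1 M\<^sub>2 :: "complex^4^3" and F :: "complex^3^3" and e\<^sub>2 :: "complex^3"
  assumes "projection_matrix M\<^sub>1" and "projection_matrix M\<^sub>2"
    and "generic_position M\<^sub>1 M\<^sub>2"
    and "is_fundamental_matrix M\<^sub>1 M\<^sub>2 F"
    and "is_epipole M\<^sub>2 M\<^sub>1 e\<^sub>2"
  shows "(\<forall>N\<^sub>1 N\<^sub>2. projection_matrix N\<^sub>1 \<and> projection_matrix N\<^sub>2 \<and> generic_position N\<^sub>1 N\<^sub>2 \<and>
            is_fundamental_matrix N\<^sub>1 N\<^sub>2 F \<longrightarrow> theta2_equivalent (M\<^sub>1, M\<^sub>2) (N\<^sub>1, N\<^sub>2))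
       \<and> (let H = map_matrix ((*) (- 1 / scalar_product e\<^sub>2 e\<^sub>2)) (cross_matrix e\<^sub>2) ** F
          in theta2_equivalent (M\<^sub>1, M\<^sub>2)
               (append_column (mat 1) 0, append_column H e\<^sub>2))"
proof -
  let ?H = "map_matrix ((*) (- 1 / scalar_product e\<^sub>2 e\<^sub>2)) (cross_matrix e\<^sub>2) ** F"
  have n: "scalar_product e\<^sub>2 e\<^sub>2 \<noteq> 0"
    using assms(3,5) by (auto simp: generic_position_def)
  then have e0: "e\<^sub>2 \<noteq> 0"
    by (auto simp: scalar_product_def)
  have M: "theta2_equivalent (M\<^sub>1, M\<^sub>2) (append_column (mat 1) 0, append_column ?H e\<^sub>2)"
    by (rule theta2_equivalent_canonical_pair[OF assms(2,4,5) n])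
  have "theta2_equivalent (M\<^sub>1, M\<^sub>2) (N\<^sub>1, N\<^sub>2)"
    if N: "projection_matrix N\<^sub>1" "projection_matrix N\<^sub>2" "generic_position N\<^sub>1 N\<^sub>2"
      "is_fundamental_matrix N\<^sub>1 N\<^sub>2 F" for N\<^sub>1 N\<^sub>2
  proof -
    obtain C where "is_center N\<^sub>1 C"
      using projection_matrix_center[OF N(1)] .
    then have e': "is_epipole N\<^sub>2 N\<^sub>1 (N\<^sub>2 *v C)"
      using vec_proj_eq_refl by (auto simp: is_epipole_def)
    have "N\<^sub>2 *v C \<noteq> 0"
      using N(3) e' by (auto simp: generic_position_def scalar_product_def)
    then have "is_epipole N\<^sub>2 N\<^sub>1 e\<^sub>2"
      using fundamental_matrix_determines_epipole[OF assms(2,4,5) e0 N(1,2,4) e'] by blast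
    then have "theta2_equivalent (N\<^sub>1, N\<^sub>2) (append_column (mat 1) 0, append_column ?H e\<^sub>2)"
      by (rule theta2_equivalent_canonical_pair[OF N(2,4) _ n])
    then show ?thesis
      by (rule theta2_equivalent_common_target[OF M])
  qed
  with M show ?thesis
    by (simp add: Let_def)
qed

end
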